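(* Let $\Sigma=(X,\sigma)$ be a topological dynamical system, with $X$ a non-empty compact Hausdorff space and $\sigma$ a homeomorphism of $X$. Let $\mathscr A$ be the set of all closed ideals of $\ell^1(\Sigma)$ and let $\mathscr B$ be the set of all $\sigma$-invariant closed subsets of $X$, both ordered by inclusion. Then $\mathcal H:\mathscr A\to\mathscr B$ and $\mathcal K:\mathscr B\to\mathscr A$ are decreasing, $\mathcal K\circ\mathcal H(I)\supset I$ for all $I\in\mathscr A$, and $\mathcal H\circ\mathcal K=\mathrm{id}_{\mathscr B}$. Let $\mathscr A_{wb}$ be the set of well behaved closed ideals of $\ell^1(\Sigma)$. Then: (1) $\mathcal H:\mathscr A_{wb}\to\mathscr B$ and $\mathcal K:\mathscr B\to\mathscr A_{wb}$ are mutually inverse bijections. (2) The following are equivalent: (a) $\mathcal H$ is injective on $\mathscr A$; (b) each closed ideal $I$ of $\ell^1(\Sigma)$ is of the form $\mathcal K(S)$ for a $\sigma$-invariant closed subset $S$ of $X$; (c) each closed ideal of $\ell^1(\Sigma)$ is well behaved; (d) for each $\sigma$-invariant closed subset $S$ of $X$, $\mathcal K(S)$ is the unique closed ideal $I'$ of $\ell^1(\Sigma)$ such that $\mathcal H(I')=S$. (3) For each well behaved closed ideal $I$ of $\ell^1(\Sigma)$, $\mathcal H(I)$ is the unique $\sigma$-invariant closed subset $S'$ of $X$ such that $\mathcal K(S')=I$. (4) If $I$ is a closed ideal of $\ell^1(\Sigma)$, then $\mathcal K\mathcal H(I)$ is the smallest well behaved closed ideal of $\ell^1(\Sigma)$ containing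 $I$, and also the largest closed ideal $I'$ of $\ell^1(\Sigma)$ such that $\mathcal H(I')=\mathcal H(I)$.
   Context: $C(X)$ is the algebra of continuous complex functions on $X$ with supremum norm, and $\alpha(f)=f\circ\sigma^{-1}$ for $f\in C(X)$. $\ell^1(\Sigma)$ is the set of maps $a:\mathbb Z\to C(X)$ with $\|a\|=\sum_n\|a(n)\|<\infty$, with product $(aa')(n)=\sum_{k\in\mathbb Z}a(k)\,\alpha^k(a'(n-k))$ and involution $a^*(n)=\overline{\alpha^n(a(-n))}$; it is a unital Banach $*$-algebra with isometric involution. Let $\delta$ be the element with value $1$ at $1$ and $0$ elsewhere, and identify $C(X)$ with the elements supported at $0$. Each $a\in\ell^1(\Sigma)$ is uniquely a norm convergent sum $a=\sum_n a_n\delta^n$ with $a_n=a(n)\in C(X)$. Ideals are two-sided. A subset $S\subset X$ is $\sigma$-invariant if $\sigma(S)=S$. $E:\ell^1(\Sigma)\to C(X)$ is $E(a)=a_0$. An ideal $I$ of $\ell^1(\Sigma)$ is well behaved if $E(I)\subset I$. For an ideal $I$ of $\ell^1(\Sigma)$, $\mathcal H(I)=\{x\in X: a_n(x)=0\text{ for all }a=\sum_n a_n\delta^n\in I\text{ and all }n\in\mathbb Z\}$. For $S\subset X$, $\mathcal K(S)=\{a=\sum_n a_n\delta^n\in\ell^1(\Sigma): a_n|_S=0\ \forall n\in\mathbb Z\}$, with $\mathcal K(\emptyset)=\ell^1(\Sigma)$. "Decreasing" means inclusion reversing. *)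

theory Defs
  imports "HOL-Analysis.Analysis" "HOL-Algebra.Ideal"
begin

text \<open>
  \<open>C(X)\<close> is the type \<open>'x \<Rightarrow>\<^sub>C complex\<close> of bounded continuous functions with the supremum
  norm; all continuous functions are bounded since \<open>'x\<close> will be assumed compact.
  The library only provides its vector space structure.
\<close>

instantiation bcontfun :: (topological_space, real_normed_algebra_1) real_normed_algebra_1
begin

definition one_bcontfun :: "'a \<Rightarrow>\<^sub>C 'b" where
  "one_bcontfun = const_bcontfun 1"

definition times_bcontfun :: "('a \<Rightarrow>\<^sub>C 'b) \<Rightarrow> ('a \<Rightarrow>\<^sub>C 'b) \<Rightarrow> 'a \<Rightarrow>\<^sub>C 'b" where
  "times_bcontfun f g = Bcontfun (\<lambda>x. apply_bcontfun f x * apply_bcontfun g x)"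

lemma apply_bcontfun_one [simp]: "apply_bcontfun (1 :: 'a \<Rightarrow>\<^sub>C 'b) x = 1"
  by (simp add: one_bcontfun_def const_bcontfun.rep_eq)

lemma apply_bcontfun_times [simp]:
  fixes f g :: "'a \<Rightarrow>\<^sub>C 'b"
  shows "apply_bcontfun (f * g) x = apply_bcontfun f x * apply_bcontfun g x"
proof -
  have "norm (apply_bcontfun f y * apply_bcontfun g y) \<le> norm f * norm g" for y
    by (rule order_trans[OF norm_mult_ineq]) (intro mult_mono norm_bounded; simp)
  then have "(\<lambda>x. apply_bcontfun f x * apply_bcontfun g x) \<in> bcontfun"
    by (auto simp: bcontfun_def bounded_iff intro!: continuous_intros)
  then show ?thesis
    by (simp add: times_bcontfun_def Bcontfun_inverse)
qed

instance
proof
  fix f g :: "'a \<Rightarrow>\<^sub>C 'b"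
  show "norm (f * g) \<le> norm f * norm g"
  proof (rule norm_bound)
    fix x
    have "norm (apply_bcontfun (f * g) x) \<le> norm (apply_bcontfun f x) * norm (apply_bcontfun g x)"
      by (simp add: norm_mult_ineq)
    also have "\<dots> \<le> norm f * norm g"
      by (intro mult_mono norm_bounded) auto
    finally show "norm (apply_bcontfun (f * g) x) \<le> norm f * norm g" .
  qed
  show "norm (1 :: 'a \<Rightarrow>\<^sub>C 'b) = 1"
    by (simp add: norm_bcontfun_def dist_bcontfun.rep_eq)
  show "(0 :: 'a \<Rightarrow>\<^sub>C 'b) \<noteq> 1"
    by (metis apply_bcontfun_one zero_bcontfun.rep_eq zero_neq_one)
qed (auto intro!: bcontfun_eqI simp: algebra_simps)

end

definition int_iterate :: "('a \<Rightarrow> 'a) \<Rightarrow> int \<Rightarrow> 'a \<Rightarrow> 'a" where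
  "int_iterate f k = (if 0 \<le> k then f ^^ nat k else inv_into UNIV f ^^ nat (- k))"

text \<open>
  \<open>inv_into UNIV \<sigma>\<close> is written out because \<open>inv \<sigma>\<close> clashes with the notation for group
  inverses. If \<open>\<sigma>\<close> is a homeomorphism, then \<open>f \<circ> \<sigma>\<^sup>-\<^sup>1\<close> is bounded and continuous, so that
  \<open>Bcontfun\<close> is applied to an element of its domain.
\<close>
definition alpha :: "('x::topological_space \<Rightarrow> 'x) \<Rightarrow> ('x \<Rightarrow>\<^sub>C complex) \<Rightarrow> ('x \<Rightarrow>\<^sub>C complex)" where
  "alpha \<sigma> f = Bcontfun (apply_bcontfun f \<circ> inv_into UNIV \<sigma>)"

text \<open>The coefficient \<open>a\<^sub>n\<close> in the expansion \<open>a = \<Sum>\<^sub>n a\<^sub>n \<delta>\<^sup>n\<close> is \<open>a n\<close>.\<close>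
definition ell1 :: "(int \<Rightarrow> ('x::topological_space \<Rightarrow>\<^sub>C complex)) set" where
  "ell1 = {a. (\<lambda>n. norm (a n)) summable_on UNIV}"

definition ell1_norm :: "(int \<Rightarrow> ('x::topological_space \<Rightarrow>\<^sub>C complex)) \<Rightarrow> real" where
  "ell1_norm a = (\<Sum>\<^sub>\<infinity>n. norm (a n))"

definition ell1_mult ::
  "('x::topological_space \<Rightarrow> 'x) \<Rightarrow> (int \<Rightarrow> ('x \<Rightarrow>\<^sub>C complex)) \<Rightarrow> (int \<Rightarrow> ('x \<Rightarrow>\<^sub>C complex))
    \<Rightarrow> int \<Rightarrow> ('x \<Rightarrow>\<^sub>C complex)" where
  "ell1_mult \<sigma> a b n = (\<Sum>\<^sub>\<infinity>k. a k * int_iterate (alpha \<sigma>) k (b (n - k)))"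

text \<open>The identification of \<open>C(X)\<close> with the elements supported at \<open>0\<close>.\<close>
definition embed0 :: "('x::topological_space \<Rightarrow>\<^sub>C complex) \<Rightarrow> int \<Rightarrow> ('x \<Rightarrow>\<^sub>C complex)" where
  "embed0 f n = (if n = 0 then f else 0)"

definition ell1_algebra ::
  "('x::topological_space \<Rightarrow> 'x) \<Rightarrow> (int \<Rightarrow> ('x \<Rightarrow>\<^sub>C complex)) ring" where
  "ell1_algebra \<sigma> =
     \<lparr>carrier = ell1, mult = ell1_mult \<sigma>, one = embed0 1,
      zero = (\<lambda>n. 0), add = (\<lambda>a b n. a n + b n)\<rparr>"

definition ell1_topology :: "(int \<Rightarrow> ('x::topological_space \<Rightarrow>\<^sub>C complex)) topology" where
  "ell1_topology = Metric_space.mtopology ell1 (\<lambda>a b. ell1_norm (\<lambda>n. a n - b n))"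

text \<open>
  Since the algebra is unital and contains the scalars, its ring ideals are automatically
  complex linear subspaces.
\<close>
definition closed_ideals ::
  "('x::topological_space \<Rightarrow> 'x) \<Rightarrow> (int \<Rightarrow> ('x \<Rightarrow>\<^sub>C complex)) set set" where
  "closed_ideals \<sigma> = {I. ideal I (ell1_algebra \<sigma>) \<and> closedin ell1_topology I}"

definition proj_E :: "(int \<Rightarrow> ('x::topological_space \<Rightarrow>\<^sub>C complex)) \<Rightarrow> ('x \<Rightarrow>\<^sub>C complex)" where
  "proj_E a = a 0"

definition well_behaved :: "(int \<Rightarrow> ('x::topological_space \<Rightarrow>\<^sub>C complex)) set \<Rightarrow> bool" where
  "well_behaved I \<longleftrightarrow> embed0 ` proj_E ` I \<subseteq> I"

definition wb_closed_ideals ::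
  "('x::topological_space \<Rightarrow> 'x) \<Rightarrow> (int \<Rightarrow> ('x \<Rightarrow>\<^sub>C complex)) set set" where
  "wb_closed_ideals \<sigma> = {I \<in> closed_ideals \<sigma>. well_behaved I}"

definition invariant_closed_sets :: "('x::topological_space \<Rightarrow> 'x) \<Rightarrow> 'x set set" where
  "invariant_closed_sets \<sigma> = {S. closed S \<and> \<sigma> ` S = S}"

definition hull_of :: "(int \<Rightarrow> ('x::topological_space \<Rightarrow>\<^sub>C complex)) set \<Rightarrow> 'x set" where
  "hull_of I = {x. \<forall>a\<in>I. \<forall>n. apply_bcontfun (a n) x = 0}"

definition kernel_of :: "'x::topological_space set \<Rightarrow> (int \<Rightarrow> ('x \<Rightarrow>\<^sub>C complex)) set" where
  "kernel_of S = {a \<in> ell1. \<forall>n. \<forall>x\<in>S. apply_bcontfun (a n) x = 0}"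

end

theory Submission
  imports Defs
begin

text \<open>
  The substantial point is that a well behaved closed ideal \<open>I\<close> contains the kernel of its hull.
  Multiplying \<open>a \<in> I\<close> by \<open>\<delta>\<^sup>-\<^sup>n\<close> and applying \<open>E\<close> shows that all coefficients \<open>a\<^sub>n\<close> belong to the
  closed ideal \<open>J = I \<inter> C(X)\<close> of \<open>C(X)\<close>, so that the zero set of \<open>J\<close> is the hull of \<open>I\<close>. A closed
  ideal of \<open>C(X)\<close> contains every function that vanishes on its zero set; hence the coefficients of
  any element of the kernel lie in \<open>J\<close>, and the element is the norm limit of its partial sums
  \<open>\<Sum> a\<^sub>n \<delta>\<^sup>n \<in> I\<close>. That the hull of the kernel of \<open>S\<close> is \<open>S\<close> is Urysohn's lemma.
\<close>

text \<open>
  The library has the next two instances for metric domains only; the infinite sum that defines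
  the product would be a junk value without completeness.
\<close>

instance bcontfun :: (topological_space, complete_space) complete_space
proof
  fix f :: "nat \<Rightarrow> 'a \<Rightarrow>\<^sub>C 'b"
  assume "Cauchy f"
  then have "uniformly_Cauchy_on UNIV (\<lambda>n. apply_bcontfun (f n))"
    unfolding Cauchy_def uniformly_Cauchy_on_def by (meson dist_fun_lt_imp_dist_val_lt)
  then obtain g where "uniform_limit UNIV (\<lambda>n. apply_bcontfun (f n)) g sequentially"
    using Cauchy_uniformly_convergent uniformly_convergent_on_def by blast
  then show "convergent f"
    by (metis uniform_limit_bcontfunE sequentially_bot convergentI)
qed

instance bcontfun :: (topological_space, banach) banach ..

text \<open>Lets point evaluation pass through finite sums and through the infinite sums that define
  the product.\<close>

lemma bounded_linear_apply_bcontfun: "bounded_linear (\<lambda>f. apply_bcontfun f x)"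
  by (rule bounded_linear_intro[of _ 1]) (auto simp: norm_bounded)

lemma apply_bcontfun_sum: "apply_bcontfun (\<Sum>i\<in>A. f i) x = (\<Sum>i\<in>A. apply_bcontfun (f i) x)"
  by (rule linear_sum[OF bounded_linear.linear[OF bounded_linear_apply_bcontfun]])

text \<open>Compactness supplies the boundedness without which \<open>Bcontfun h\<close> would be an
  unspecified value.\<close>

lemma apply_Bcontfun_compact:
  fixes h :: "'a::topological_space \<Rightarrow> 'b::metric_space"
  assumes "compact (UNIV :: 'a set)" "continuous_on UNIV h"
  shows "apply_bcontfun (Bcontfun h) = h"
  using assms compact_continuous_image compact_imp_bounded
  by (intro Bcontfun_inverse) (auto simp: bcontfun_def)

subsection \<open>Closed ideals of \<open>C(X)\<close>\<close>

text \<open>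
  A finite sum \<open>G = \<Sum> \<bar>g\<bar>\<^sup>2\<close> of elements of the ideal is bounded below on the compact set
  where \<open>\<bar>f\<bar> \<ge> e\<close>, and \<open>f - f t G / (1 + t G) = f / (1 + t G)\<close> is uniformly small for large \<open>t\<close>.
\<close>
lemma closed_ideal_bcontfun_vanishing:
  fixes J :: "('x::topological_space \<Rightarrow>\<^sub>C complex) set"
  assumes comp: "compact (UNIV :: 'x set)" and "closed J" and zero: "0 \<in> J"
    and add: "\<And>f g. f \<in> J \<Longrightarrow> g \<in> J \<Longrightarrow> f + g \<in> J"
    and mult: "\<And>f h. f \<in> J \<Longrightarrow> h * f \<in> J"
    and van: "\<And>x. (\<And>g. g \<in> J \<Longrightarrow> apply_bcontfun g x = 0) \<Longrightarrow> apply_bcontfun f x = 0"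
  shows "f \<in> J"
proof -
  have approx: "\<exists>F\<in>J. dist F f \<le> e" if "e > 0" for e :: real
  proof -
    define K where "K = {x. e \<le> norm (apply_bcontfun f x)}"
    have "closed K"
      unfolding K_def by (intro closed_Collect_le continuous_intros continuous_on_apply_bcontfun)
    then have "compact K"
      using compact_Int_closed[OF comp] by simp
    moreover have "open {x. apply_bcontfun g x \<noteq> 0}" for g :: "'x \<Rightarrow>\<^sub>C complex"
      by (intro open_Collect_neq continuous_intros continuous_on_apply_bcontfun)
    \<comment> \<open>On \<open>K\<close> the function \<open>f\<close> is nonzero, so by
      \<open>van\<close> some element of \<open>J\<close> is nonzero there too.\<close>
    moreover have "K \<subseteq> (\<Union>g\<in>J. {x. apply_bcontfun g x \<noteq> 0})"
    proof
      fix x assume "x \<in> K"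
      then have "apply_bcontfun f x \<noteq> 0"
        using \<open>e > 0\<close> by (auto simp: K_def)
      then show "x \<in> (\<Union>g\<in>J. {x. apply_bcontfun g x \<noteq> 0})"
        using van[of x] by auto
    qed
    ultimately obtain D where D: "D \<subseteq> J" "finite D"
      "K \<subseteq> (\<Union>g\<in>D. {x. apply_bcontfun g x \<noteq> 0})"
      by (elim compactE_image)
    \<comment> \<open>The factor \<open>cnj g\<close> turns each summand into |g|^2 and keeps it in
      \<open>J\<close> by absorption.\<close>
    define G where "G = (\<Sum>g\<in>D. Bcontfun (\<lambda>x. cnj (apply_bcontfun g x)) * g)"
    define r where "r x = (\<Sum>g\<in>D. (cmod (apply_bcontfun g x))\<^sup>2)" for x
    have "G \<in> J"
      unfolding G_def using D(2,1) by (induction D rule: finite_induct) (auto intro: zero add mult)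
    have G: "apply_bcontfun G x = of_real (r x)" for x
    proof -
      have "apply_bcontfun (Bcontfun (\<lambda>x. cnj (apply_bcontfun g x))) = (\<lambda>x. cnj (apply_bcontfun g x))"
        for g :: "'x \<Rightarrow>\<^sub>C complex"
        by (intro apply_Bcontfun_compact comp continuous_intros continuous_on_apply_bcontfun)
      then show ?thesis
        by (simp add: G_def r_def apply_bcontfun_sum complex_norm_square mult.commute del: of_real_power)
    qed
    have r_nonneg: "r x \<ge> 0" for x
      by (simp add: r_def sum_nonneg)
    have r_pos: "r x > 0" if "x \<in> K" for x
    proof -
      obtain g where g: "g \<in> D" "apply_bcontfun g x \<noteq> 0"
        using D(3) \<open>x \<in> K\<close> by blast
      have "0 < (cmod (apply_bcontfun g x))\<^sup>2"
        using g by simp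
      also have "\<dots> \<le> r x"
        unfolding r_def by (rule member_le_sum) (use g D in auto)
      finally show ?thesis .
    qed
    have r_cont: "continuous_on A r" for A
      unfolding r_def by (intro continuous_intros continuous_on_apply_bcontfun)
    obtain m where m: "m > 0" "\<And>x. x \<in> K \<Longrightarrow> m \<le> r x"
    proof (cases "K = {}")
      case False
      then obtain x0 where "x0 \<in> K" "\<forall>y\<in>K. r x0 \<le> r y"
        using continuous_attains_inf[OF \<open>compact K\<close> _ r_cont] by auto
      then show thesis
        using that r_pos by blast
    qed (use that[of 1] in auto)
    \<comment> \<open>Chosen so that t r >= norm f / e on \<open>K\<close>, which gives |f| / (1 + t
      r) <= e there. Off \<open>K\<close> already |f| < e, and the denominator is at least
      1.\<close>
    define t where "t = norm f / (e * m)"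
    have "t \<ge> 0"
      using m \<open>e > 0\<close> by (simp add: t_def)
    then have den: "1 + t * r x > 0" for x
      using r_nonneg[of x] by (simp add: add_pos_nonneg)
    define h where "h = Bcontfun (\<lambda>x. of_real (t / (1 + t * r x)) :: complex)"
    have "continuous_on UNIV (\<lambda>x. of_real (t / (1 + t * r x)) :: complex)"
      using den by (intro continuous_intros r_cont) (auto simp: less_imp_neq[symmetric])
    then have h: "apply_bcontfun h x = of_real (t / (1 + t * r x))" for x
      using comp by (simp add: h_def apply_Bcontfun_compact)
    have "dist (f * h * G) f \<le> e"
    proof -
      have "norm (apply_bcontfun (f * h * G - f) x) \<le> e" for x
      proof -
        have eq: "t / (1 + t * r x) * r x - 1 = - (1 / (1 + t * r x))"
          using den[of x] by (simp add: field_simps)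
        have "apply_bcontfun (f * h * G - f) x =
            apply_bcontfun f x * of_real (t / (1 + t * r x) * r x - 1)"
          by (simp add: h G algebra_simps)
        then have "norm (apply_bcontfun (f * h * G - f) x) =
            norm (apply_bcontfun f x) / (1 + t * r x)"
          unfolding eq using den[of x]
          by (simp add: norm_mult norm_divide del: of_real_add of_real_mult of_real_minus of_real_divide)
        also have "\<dots> \<le> e"
        proof (cases "x \<in> K")
          case True
          have "norm f / e = t * m"
            using m by (simp add: t_def)
          also have "\<dots> \<le> t * r x"
            using m(2)[OF True] \<open>t \<ge> 0\<close> by (rule mult_left_mono)
          finally have "norm f \<le> e * (t * r x)"
            using \<open>e > 0\<close> by (simp add: field_simps)
          then have "norm (apply_bcontfun f x) \<le> e * (1 + t * r x)"
            using norm_bounded[of f x] \<open>e > 0\<close> by (simp add: distrib_left)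
          then show ?thesis
            using den[of x] by (simp add: divide_le_eq)
        next
          case False
          then have "norm (apply_bcontfun f x) \<le> e * 1"
            by (simp add: K_def)
          also have "\<dots> \<le> e * (1 + t * r x)"
            using \<open>t \<ge> 0\<close> r_nonneg[of x] \<open>e > 0\<close> by (intro mult_left_mono) auto
          finally show ?thesis
            using den[of x] by (simp add: divide_le_eq)
        qed
        finally show ?thesis .
      qed
      then show ?thesis
        unfolding dist_norm by (rule norm_bound)
    qed
    then show ?thesis
      using mult[OF \<open>G \<in> J\<close>] by blast
  qed
  have "\<exists>F\<in>J. dist F f < e" if "e > 0" for e :: real
    using approx[of "e / 2"] that by force
  then show ?thesis
    using closed_approachable[OF \<open>closed J\<close>] by blast
qed

subsection \<open>Integer iterates and the action on \<open>C(X)\<close>\<close>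

lemma int_iterate_add1:
  assumes "bij f"
  shows "int_iterate f (k + 1) x = f (int_iterate f k x)"
proof (cases "k \<ge> 0")
  case True
  then have "nat (k + 1) = Suc (nat k)" by simp
  with True show ?thesis by (simp add: int_iterate_def)
next
  case False
  \<comment> \<open>For negative \<open>k\<close> the outer \<open>f\<close> cancels one inverse
    factor. The case k = -1 is separate because k + 1 = 0 falls into the other branch of the
    definition.\<close>
  then have "nat (- k) = Suc (nat (- (k + 1)))" by simp
  with False show ?thesis
    using surj_f_inv_f[OF bij_is_surj[OF assms]] by (cases "k = - 1") (auto simp: int_iterate_def)
qed

lemma int_iterate_diff1:
  assumes "bij f"
  shows "int_iterate f (k - 1) x = inv_into UNIV f (int_iterate f k x)"
  using int_iterate_add1[OF assms, of "k - 1" x] inv_f_f[OF bij_is_inj[OF assms]] by simp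

lemma int_iterate_0 [simp]: "int_iterate f 0 x = x"
  by (simp add: int_iterate_def)

lemma int_iterate_add:
  assumes "bij f"
  shows "int_iterate f (j + k) x = int_iterate f j (int_iterate f k x)"
proof (induction j rule: int_induct[of _ 0])
  case (step1 i)
  then show ?case
    using int_iterate_add1[OF assms, of "i + k" x] int_iterate_add1[OF assms, of i]
    by (simp add: ac_simps)
next
  case (step2 i)
  then show ?case
    using int_iterate_diff1[OF assms, of "i + k" x] int_iterate_diff1[OF assms, of i]
    by (simp add: algebra_simps)
qed simp

locale homeomorphic_system =
  fixes \<sigma> :: "'x::topological_space \<Rightarrow> 'x"
  assumes bij: "bij \<sigma>"
    and cont: "continuous_on UNIV \<sigma>"
    and cont_inv: "continuous_on UNIV (inv_into UNIV \<sigma>)"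
begin

abbreviation "A \<equiv> int_iterate (alpha \<sigma>)"
abbreviation "T \<equiv> int_iterate \<sigma>"

lemma T_1: "T 1 x = \<sigma> x" and T_minus_1: "T (- 1) x = inv_into UNIV \<sigma> x"
  using int_iterate_add1[OF bij, of 0 x] int_iterate_diff1[OF bij, of 0 x] by simp_all

text \<open>The bound of \<open>f\<close> carries over to the composite, so \<open>Bcontfun\<close>
  stays inside its domain both for \<open>alpha\<close> and for its inverse.\<close>

lemma comp_bcontfun:
  fixes f :: "'x \<Rightarrow>\<^sub>C complex"
  assumes "continuous_on UNIV h"
  shows "apply_bcontfun f \<circ> h \<in> bcontfun"
proof (rule bcontfun_normI)
  show "continuous_on UNIV (apply_bcontfun f \<circ> h)"
    using assms by (intro continuous_on_compose continuous_on_apply_bcontfun)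
  show "norm ((apply_bcontfun f \<circ> h) x) \<le> norm f" for x
    by (simp add: norm_bounded)
qed

lemma alpha_apply: "apply_bcontfun (alpha \<sigma> f) x = apply_bcontfun f (inv_into UNIV \<sigma> x)"
  by (simp add: alpha_def Bcontfun_inverse[OF comp_bcontfun[OF cont_inv]])

text \<open>Needed because the negative iterates of \<open>alpha\<close> are built from
  \<open>inv_into\<close>, a genuine inverse only for a bijection. The preimage of \<open>g\<close>
  is \<open>g\<close> composed with \<open>\<sigma>\<close>.\<close>

lemma bij_alpha: "bij (alpha \<sigma>)"
proof (rule bijI)
  show "inj (alpha \<sigma>)"
  proof (rule injI, rule bcontfun_eqI)
    fix f g x assume "alpha \<sigma> f = alpha \<sigma> g"
    then have "apply_bcontfun (alpha \<sigma> f) (\<sigma> x) = apply_bcontfun (alpha \<sigma> g) (\<sigma> x)"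
      by simp
    then show "apply_bcontfun f x = apply_bcontfun g x"
      by (simp add: alpha_apply inv_f_f[OF bij_is_inj[OF bij]])
  qed
  show "surj (alpha \<sigma>)"
  proof (rule surjI)
    show "alpha \<sigma> (Bcontfun (apply_bcontfun g \<circ> \<sigma>)) = g" for g
      by (rule bcontfun_eqI)
        (simp add: alpha_apply Bcontfun_inverse[OF comp_bcontfun[OF cont]]
          surj_f_inv_f[OF bij_is_surj[OF bij]])
  qed
qed

lemma inv_alpha_apply: "apply_bcontfun (inv_into UNIV (alpha \<sigma>) g) x = apply_bcontfun g (\<sigma> x)"
  using alpha_apply[of "inv_into UNIV (alpha \<sigma>) g" "\<sigma> x"]
  by (simp add: surj_f_inv_f[OF bij_is_surj[OF bij_alpha]] inv_f_f[OF bij_is_inj[OF bij]])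

text \<open>As a simp rule it reduces identities between iterates of \<open>alpha\<close> to
  pointwise ones.\<close>

lemma A_apply [simp]: "apply_bcontfun (A k f) x = apply_bcontfun f (T (- k) x)"
proof (induction k arbitrary: x rule: int_induct[of _ 0])
  case (step1 i)
  have "T (- i) (inv_into UNIV \<sigma> x) = T (- (i + 1)) x"
    using int_iterate_add[OF bij, of "- i" "- 1" x] by (simp add: T_minus_1)
  with step1 show ?case
    by (simp add: int_iterate_add1[OF bij_alpha] alpha_apply)
next
  case (step2 i)
  have "T (- i) (\<sigma> x) = T (- (i - 1)) x"
    using int_iterate_add[OF bij, of "- i" 1 x] by (simp add: T_1)
  with step2 show ?case
    by (simp add: int_iterate_diff1[OF bij_alpha] inv_alpha_apply)
qed simp

lemma A_A: "A j (A k f) = A (j + k) f"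
  by (simp add: int_iterate_add[OF bij_alpha])

lemma A_algebra [simp]:
  "A k (f + g) = A k f + A k g" "A k (f * g) = A k f * A k g" "A k 1 = 1" "A k 0 = 0"
  by (auto intro!: bcontfun_eqI)

text \<open>Every iterate is a contraction, and so is its inverse \<open>A (- k)\<close>.\<close>

lemma norm_A [simp]: "norm (A k f) = norm f"
proof -
  have le: "norm (A j g) \<le> norm g" for j g
    by (rule norm_bound) (simp add: norm_bounded)
  show ?thesis
    using le[of k f] le[of "- k" "A k f"] by (simp add: A_A)
qed

lemma bounded_linear_A: "bounded_linear (A k)"
  by (rule bounded_linear_intro[of _ 1]) (auto intro: bcontfun_eqI)

end

subsection \<open>The ring \<open>\<ell>\<^sup>1(\<Sigma>)\<close>\<close>

text \<open>The monomial f delta^k.\<close>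

definition single :: "int \<Rightarrow> ('x::topological_space \<Rightarrow>\<^sub>C complex) \<Rightarrow> int \<Rightarrow> ('x \<Rightarrow>\<^sub>C complex)" where
  "single k f n = (if n = k then f else 0)"

lemma embed0_eq_single: "embed0 f = single 0 f"
  by (simp add: fun_eq_iff embed0_def single_def)

lemma finite_support_ell1:
  assumes "finite F" "\<And>n. n \<notin> F \<Longrightarrow> a n = 0"
  shows "a \<in> ell1"
  unfolding ell1_def mem_Collect_eq summable_on_def
  by (rule exI, rule has_sum_finite_neutralI[of F]) (use assms in auto)

lemma single_ell1: "single k f \<in> ell1"
  by (rule finite_support_ell1[of "{k}"]) (auto simp: single_def)

lemma ell1_norm_nonneg: "ell1_norm a \<ge> 0"
  unfolding ell1_norm_def by (rule infsum_nonneg) simp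

text \<open>Continuity of the coefficient maps: it separates points in the metric, makes kernels
  closed and dominates the terms of the convolution.\<close>

lemma norm_coeff_le_ell1_norm:
  assumes "a \<in> ell1"
  shows "norm (a n) \<le> ell1_norm a"
  using finite_sum_le_infsum[of "\<lambda>n. norm (a n)" UNIV "{n}"] assms
  by (simp add: ell1_def ell1_norm_def)

lemma ell1_norm_single: "ell1_norm (single k f) = norm f"
  unfolding ell1_norm_def
  by (rule infsumI, rule has_sum_finite_neutralI[of "{k}"]) (auto simp: single_def)

lemma ell1_add:
  assumes "a \<in> ell1" "b \<in> ell1"
  shows "(\<lambda>n. a n + b n) \<in> ell1"
  using assms unfolding ell1_def mem_Collect_eq
  by (intro Infinite_Sum.abs_summable_on_comparison_test'[OF summable_on_add norm_triangle_ineq])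

lemma ell1_uminus: "a \<in> ell1 \<Longrightarrow> (\<lambda>n. - a n) \<in> ell1"
  by (simp add: ell1_def)

lemma ell1_diff:
  assumes "a \<in> ell1" "b \<in> ell1"
  shows "(\<lambda>n. a n - b n) \<in> ell1"
  using ell1_add[OF assms(1) ell1_uminus[OF assms(2)]] by simp

lemma ell1_norm_triangle:
  assumes "a \<in> ell1" "b \<in> ell1"
  shows "ell1_norm (\<lambda>n. a n + b n) \<le> ell1_norm a + ell1_norm b"
proof -
  have "(\<lambda>n. norm (a n)) summable_on UNIV" "(\<lambda>n. norm (b n)) summable_on UNIV"
    "(\<lambda>n. norm (a n + b n)) summable_on UNIV"
    using assms ell1_add[OF assms] by (auto simp: ell1_def)
  then show ?thesis
    unfolding ell1_norm_def
    by (subst infsum_add[symmetric]) (auto intro!: infsum_mono summable_on_add norm_triangle_ineq)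
qed

lemma Metric_space_ell1:
  "Metric_space (ell1 :: (int \<Rightarrow> ('x::topological_space \<Rightarrow>\<^sub>C complex)) set)
     (\<lambda>a b. ell1_norm (\<lambda>n. a n - b n))"
proof
  fix a b c :: "int \<Rightarrow> ('x \<Rightarrow>\<^sub>C complex)"
  show "0 \<le> ell1_norm (\<lambda>n. a n - b n)"
    by (rule ell1_norm_nonneg)
  show "ell1_norm (\<lambda>n. a n - b n) = ell1_norm (\<lambda>n. b n - a n)"
    by (simp add: ell1_norm_def norm_minus_commute)
  assume ab: "a \<in> ell1" "b \<in> ell1"
  show "ell1_norm (\<lambda>n. a n - b n) = 0 \<longleftrightarrow> a = b"
  proof
    assume "ell1_norm (\<lambda>n. a n - b n) = 0"
    then show "a = b"
      using norm_coeff_le_ell1_norm[OF ell1_diff[OF ab]] by (auto simp: fun_eq_iff)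
  qed (simp add: ell1_norm_def)
  assume "c \<in> ell1"
  with ab show "ell1_norm (\<lambda>n. a n - c n) \<le> ell1_norm (\<lambda>n. a n - b n) + ell1_norm (\<lambda>n. b n - c n)"
    using ell1_norm_triangle[of "\<lambda>n. a n - b n" "\<lambda>n. b n - c n"] by (simp add: ell1_diff)
qed

text \<open>Replaces the abstract metric topology by approximation in norm, the form in which
  closedness is checked and used for ideals.\<close>

lemma closedin_ell1_iff:
  "closedin ell1_topology C \<longleftrightarrow>
     C \<subseteq> ell1 \<and> (\<forall>a\<in>ell1. (\<forall>e>0. \<exists>b\<in>C. ell1_norm (\<lambda>n. a n - b n) < e) \<longrightarrow> a \<in> C)"
proof -
  interpret Metric_space "ell1 :: (int \<Rightarrow> ('a \<Rightarrow>\<^sub>C complex)) set"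
      "\<lambda>a b. ell1_norm (\<lambda>n. a n - b n)"
    by (rule Metric_space_ell1)
  show ?thesis
    unfolding ell1_topology_def closedin_metric disjnt_iff in_mball by blast
qed

section \<open>Convolution: convergence, associativity and the ring axioms\<close>

context homeomorphic_system
begin

lemma norm_conv_term_le: "norm (a * A k b) \<le> norm a * norm b"
  using norm_mult_ineq[of a "A k b"] by simp

text \<open>Ensures that the sum defining the product never takes the default value 0: the series
  converges absolutely and C(X) is complete.\<close>

lemma conv_summable:
  assumes "a \<in> ell1" "b \<in> ell1"
  shows "(\<lambda>k. a k * A k (b (n - k))) summable_on UNIV"
proof (rule abs_summable_summable, rule Infinite_Sum.abs_summable_on_comparison_test')
  show "(\<lambda>k. norm (a k) * ell1_norm b) summable_on UNIV"
    using assms by (auto simp: ell1_def intro: summable_on_cmult_left)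
  show "norm (a k * A k (b (n - k))) \<le> norm (a k) * ell1_norm b" for k
    by (rule order_trans[OF norm_conv_term_le])
      (intro mult_left_mono norm_coeff_le_ell1_norm assms norm_ge_zero)
qed

text \<open>The product family norm (a k) * norm (b m) is summable over all pairs; the substitution
  m = n - k only reindexes it. Both closure under products and associativity rest on this
  bound.\<close>

lemma norm_shifted_pairs_summable:
  assumes "a \<in> ell1" "b \<in> ell1"
  shows "(\<lambda>(n, k). norm (a k) * norm (b (n - k))) summable_on UNIV \<times> UNIV"
proof -
  have "(\<lambda>(k, m). norm (a k) * norm (b m)) summable_on (UNIV \<times> UNIV)"
  proof (rule summable_on_SigmaI)
    show "((\<lambda>m. case (k, m) of (k, m) \<Rightarrow> norm (a k) * norm (b m)) has_sum norm (a k) * ell1_norm b) UNIV"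
      for k
      using assms by (auto simp: ell1_def ell1_norm_def intro!: has_sum_cmult_right)
    show "(\<lambda>k. norm (a k) * ell1_norm b) summable_on UNIV"
      using assms by (auto simp: ell1_def intro: summable_on_cmult_left)
  qed auto
  then show ?thesis
    by (subst summable_on_reindex_bij_witness[where j = "\<lambda>(n, k). (k, n - k)"
          and i = "\<lambda>(k, m). (k + m, k)" and T = "UNIV \<times> UNIV"
          and h = "\<lambda>(k, m). norm (a k) * norm (b m)"]) auto
qed

lemma ell1_mult_closed:
  assumes "a \<in> ell1" "b \<in> ell1"
  shows "ell1_mult \<sigma> a b \<in> ell1"
  unfolding ell1_def mem_Collect_eq
proof (rule Infinite_Sum.abs_summable_on_comparison_test')
  have pairs: "(\<lambda>(n, k). norm (a k * A k (b (n - k)))) summable_on UNIV \<times> UNIV"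
    using Infinite_Sum.abs_summable_on_comparison_test'[OF norm_shifted_pairs_summable[OF assms],
        of "\<lambda>(n, k). a k * A k (b (n - k))"] norm_conv_term_le
    by (simp add: case_prod_unfold)
  then show "(\<lambda>n. \<Sum>\<^sub>\<infinity>k. norm (a k * A k (b (n - k)))) summable_on UNIV"
    using summable_on_Sigma_banach[of "\<lambda>n k. norm (a k * A k (b (n - k)))"] by simp
  show "norm (ell1_mult \<sigma> a b n) \<le> (\<Sum>\<^sub>\<infinity>k. norm (a k * A k (b (n - k))))" for n
    unfolding ell1_mult_def
    using summable_on_SigmaD1[OF pairs] by (intro norm_infsum_bound) auto
qed

text \<open>The pointwise series shows at which points of an orbit the coefficients are evaluated,
  hence why vanishing on an invariant set is inherited by products.\<close>

lemma ell1_mult_apply_has_sum: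
  assumes "a \<in> ell1" "b \<in> ell1"
  shows "((\<lambda>k. apply_bcontfun (a k) x * apply_bcontfun (b (n - k)) (T (- k) x)) has_sum
    apply_bcontfun (ell1_mult \<sigma> a b n) x) UNIV"
  using has_sum_bounded_linear[OF bounded_linear_apply_bcontfun[of x]
      has_sum_infsum[OF conv_summable[OF assms, of n]]]
  by (simp add: ell1_mult_def)

lemma ell1_mult_single_left: "ell1_mult \<sigma> (single k f) b n = f * A k (b (n - k))"
  unfolding ell1_mult_def
  by (rule infsumI, rule has_sum_finite_neutralI[of "{k}"]) (auto simp: single_def)

lemma ell1_mult_single_right: "ell1_mult \<sigma> a (single k f) n = a (n - k) * A (n - k) f"
  unfolding ell1_mult_def
  \<comment> \<open>The summation index i contributes only if n - i = k.\<close>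
  by (rule infsumI, rule has_sum_finite_neutralI[of "{n - k}"]) (auto simp: single_def)

lemma ell1_mult_assoc:
  assumes a: "a \<in> ell1" and b: "b \<in> ell1" and c: "c \<in> ell1"
  shows "ell1_mult \<sigma> (ell1_mult \<sigma> a b) c = ell1_mult \<sigma> a (ell1_mult \<sigma> b c)"
proof
  fix n
  \<comment> \<open>Both bracketings are iterated sums of this family, with \<open>j\<close> the
    degree taken from \<open>a\<close> and \<open>k\<close> the degree taken from \<open>ab\<close>.
    Absolute summability permits the exchange.\<close>
  define S where "S k j = a j * A j (b (k - j)) * A k (c (n - k))" for k j
  have "(\<lambda>(k, j). S k j) summable_on UNIV \<times> UNIV"
  proof (rule abs_summable_summable, rule Infinite_Sum.abs_summable_on_comparison_test')
    show "(\<lambda>p. (\<lambda>(k, j). norm (a j) * norm (b (k - j))) p * ell1_norm c) summable_on UNIV \<times> UNIV"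
      by (intro summable_on_cmult_left norm_shifted_pairs_summable a b)
    have "norm (S k j) \<le> norm (a j) * norm (b (k - j)) * ell1_norm c" for k j
      unfolding S_def
      by (rule order_trans[OF norm_conv_term_le])
        (intro mult_mono norm_conv_term_le norm_coeff_le_ell1_norm c mult_nonneg_nonneg norm_ge_zero)
    then show "norm (case p of (k, j) \<Rightarrow> S k j)
        \<le> (\<lambda>(k, j). norm (a j) * norm (b (k - j))) p * ell1_norm c" for p
      by (cases p) simp
  qed
  then have swap: "(\<Sum>\<^sub>\<infinity>k. \<Sum>\<^sub>\<infinity>j. S k j) = (\<Sum>\<^sub>\<infinity>j. \<Sum>\<^sub>\<infinity>k. S k j)"
    by (rule infsum_swap_banach)
  have left: "ell1_mult \<sigma> a b k * A k (c (n - k)) = (\<Sum>\<^sub>\<infinity>j. S k j)" for k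
    unfolding S_def ell1_mult_def
    by (rule infsum_cmult_left[symmetric]) (intro conv_summable a b)
  have right: "a j * A j (ell1_mult \<sigma> b c (n - j)) = (\<Sum>\<^sub>\<infinity>k. S k j)" for j
  proof -
    have "bounded_linear (\<lambda>f. a j * A j f)"
      using bounded_linear_compose[OF bounded_linear_mult_right bounded_linear_A] .
    from has_sum_bounded_linear[OF this has_sum_infsum[OF conv_summable[OF b c]]]
    have "a j * A j (ell1_mult \<sigma> b c (n - j)) =
        (\<Sum>\<^sub>\<infinity>m. a j * A j (b m * A m (c (n - j - m))))"
      unfolding ell1_mult_def by (rule infsumI[symmetric])
    also have "\<dots> = (\<Sum>\<^sub>\<infinity>k. S k j)"
      \<comment> \<open>Substitute k = m + j and merge the two iterates of \<open>alpha\<close> by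
        \<open>A_A\<close>.\<close>
      by (rule infsum_reindex_bij_witness[where j = "\<lambda>m. m + j" and i = "\<lambda>k. k - j"])
        (auto simp: S_def A_A mult.assoc algebra_simps)
    finally show ?thesis .
  qed
  show "ell1_mult \<sigma> (ell1_mult \<sigma> a b) c n = ell1_mult \<sigma> a (ell1_mult \<sigma> b c) n"
    unfolding ell1_mult_def[of \<sigma> "ell1_mult \<sigma> a b"] ell1_mult_def[of \<sigma> a "ell1_mult \<sigma> b c"]
      left right
    by (rule swap)
qed

text \<open>The predicate \<open>ideal\<close> includes the ring axioms, so they are due before any
  kernel can be shown to be an ideal.\<close>

lemma ring_ell1: "ring (ell1_algebra \<sigma>)"
proof (rule ringI)
  show "abelian_group (ell1_algebra \<sigma>)"
  proof (rule abelian_groupI)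
    fix a assume "a \<in> carrier (ell1_algebra \<sigma>)"
    then show "\<exists>y\<in>carrier (ell1_algebra \<sigma>). y \<oplus>\<^bsub>ell1_algebra \<sigma>\<^esub> a = \<zero>\<^bsub>ell1_algebra \<sigma>\<^esub>"
      by (intro bexI[of _ "\<lambda>n. - a n"]) (auto simp: ell1_algebra_def ell1_uminus)
  qed (auto simp: ell1_algebra_def ell1_add fun_eq_iff intro: finite_support_ell1[of "{}"])
  show "monoid (ell1_algebra \<sigma>)"
    by (rule monoidI)
      (auto simp: ell1_algebra_def ell1_mult_closed ell1_mult_assoc embed0_eq_single single_ell1
        ell1_mult_single_left ell1_mult_single_right fun_eq_iff)
qed (auto simp: ell1_algebra_def ell1_mult_def fun_eq_iff algebra_simps conv_summable ell1_add
    simp flip: infsum_add)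

end

subsection \<open>Hulls and kernels\<close>

context homeomorphic_system
begin

lemma closed_idealD:
  assumes "I \<in> closed_ideals \<sigma>"
  shows "I \<subseteq> ell1" "(\<lambda>n. 0) \<in> I"
    and "\<And>a b. a \<in> I \<Longrightarrow> b \<in> I \<Longrightarrow> (\<lambda>n. a n + b n) \<in> I"
    and "\<And>a b. a \<in> I \<Longrightarrow> b \<in> ell1 \<Longrightarrow> ell1_mult \<sigma> b a \<in> I"
    and "\<And>a b. a \<in> I \<Longrightarrow> b \<in> ell1 \<Longrightarrow> ell1_mult \<sigma> a b \<in> I"
    and "\<And>a. a \<in> ell1 \<Longrightarrow> (\<And>e. e > 0 \<Longrightarrow> \<exists>b\<in>I. ell1_norm (\<lambda>n. a n - b n) < e) \<Longrightarrow> a \<in> I"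
proof -
  interpret ideal I "ell1_algebra \<sigma>"
    using assms by (simp add: closed_ideals_def)
  show "I \<subseteq> ell1" "(\<lambda>n. 0) \<in> I"
    "\<And>a b. a \<in> I \<Longrightarrow> b \<in> I \<Longrightarrow> (\<lambda>n. a n + b n) \<in> I"
    "\<And>a b. a \<in> I \<Longrightarrow> b \<in> ell1 \<Longrightarrow> ell1_mult \<sigma> b a \<in> I"
    "\<And>a b. a \<in> I \<Longrightarrow> b \<in> ell1 \<Longrightarrow> ell1_mult \<sigma> a b \<in> I"
    using a_subset additive_subgroup.zero_closed[OF is_additive_subgroup]
      additive_subgroup.a_closed[OF is_additive_subgroup] I_l_closed I_r_closed
    by (simp_all add: ell1_algebra_def)
  show "a \<in> I" if "a \<in> ell1" "\<And>e. e > 0 \<Longrightarrow> \<exists>b\<in>I. ell1_norm (\<lambda>n. a n - b n) < e" for a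
    using assms that by (auto simp: closed_ideals_def closedin_ell1_iff)
qed

lemma hull_of_invariant_closed:
  assumes I: "I \<in> closed_ideals \<sigma>"
  shows "hull_of I \<in> invariant_closed_sets \<sigma>"
proof -
  have "hull_of I = (\<Inter>a\<in>I. \<Inter>n. {x. apply_bcontfun (a n) x = 0})"
    by (auto simp: hull_of_def)
  moreover have "closed {x. apply_bcontfun f x = 0}" for f :: "'x \<Rightarrow>\<^sub>C complex"
    by (intro closed_Collect_eq continuous_intros continuous_on_apply_bcontfun)
  ultimately have "closed (hull_of I)"
    by (simp add: closed_INT)
  \<comment> \<open>The coefficient of delta^(-k) a at n - k is \<open>a n\<close> composed with
    sigma^k. The cases k = 1 and k = -1 then give the two inclusions of invariance.\<close>
  have T_hull: "T k x \<in> hull_of I" if x: "x \<in> hull_of I" for k x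
    unfolding hull_of_def
  proof (intro CollectI ballI allI)
    fix a n assume "a \<in> I"
    then have "ell1_mult \<sigma> (single (- k) 1) a \<in> I"
      using closed_idealD(4)[OF I] single_ell1 by blast
    then have "apply_bcontfun (ell1_mult \<sigma> (single (- k) 1) a (n - k)) x = 0"
      using x by (auto simp: hull_of_def)
    then show "apply_bcontfun (a n) (T k x) = 0"
      by (simp add: ell1_mult_single_left)
  qed
  have "\<sigma> ` hull_of I \<subseteq> hull_of I"
    using T_hull[of _ 1] by (auto simp: T_1)
  moreover have "x \<in> \<sigma> ` hull_of I" if "x \<in> hull_of I" for x
    using T_hull[OF that, of "- 1"] surj_f_inv_f[OF bij_is_surj[OF bij], of x]
    by (metis T_minus_1 image_eqI)
  ultimately show ?thesis
    using \<open>closed (hull_of I)\<close> by (auto simp: invariant_closed_sets_def)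
qed

lemma T_invariant:
  assumes S: "\<sigma> ` S = S" and "x \<in> S"
  shows "T k x \<in> S"
proof (induction k rule: int_induct[of _ 0])
  case (step1 i)
  then show ?case
    using S by (auto simp: int_iterate_add1[OF bij])
next
  case (step2 i)
  then obtain y where "y \<in> S" "T i x = \<sigma> y"
    using S by blast
  then show ?case
    by (simp add: int_iterate_diff1[OF bij] inv_f_f[OF bij_is_inj[OF bij]])
qed (use assms in simp)

section \<open>Kernels of invariant closed sets\<close>

lemma kernel_of_closed_ideal:
  assumes "S \<in> invariant_closed_sets \<sigma>"
  shows "kernel_of S \<in> closed_ideals \<sigma>"
proof -
  have inv: "T k x \<in> S" if "x \<in> S" for x k
    using T_invariant assms that by (auto simp: invariant_closed_sets_def)
  have l_closed: "ell1_mult \<sigma> b a \<in> kernel_of S" and r_closed: "ell1_mult \<sigma> a b \<in> kernel_of S"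
    if "a \<in> kernel_of S" "b \<in> ell1" for a b
  proof -
    have a: "a \<in> ell1" "\<And>n x. x \<in> S \<Longrightarrow> apply_bcontfun (a n) x = 0"
      using that(1) by (auto simp: kernel_of_def)
    \<comment> \<open>In \<open>b a\<close> the coefficients of \<open>a\<close> are evaluated along
      the orbit of \<open>x\<close>, which stays in \<open>S\<close>; in \<open>a b\<close> they are
      evaluated at \<open>x\<close> itself.\<close>
    have "apply_bcontfun (ell1_mult \<sigma> b a n) x = 0" if "x \<in> S" for x n
      using ell1_mult_apply_has_sum[OF \<open>b \<in> ell1\<close> a(1), of x n] a(2)[OF inv[OF that]]
      by (auto dest: has_sum_unique[OF has_sum_0[OF refl]])
    moreover have "apply_bcontfun (ell1_mult \<sigma> a b n) x = 0" if "x \<in> S" for x n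
      using ell1_mult_apply_has_sum[OF a(1) \<open>b \<in> ell1\<close>, of x n] a(2)[OF that]
      by (auto dest: has_sum_unique[OF has_sum_0[OF refl]])
    ultimately show "ell1_mult \<sigma> b a \<in> kernel_of S" "ell1_mult \<sigma> a b \<in> kernel_of S"
      using that a(1) by (auto simp: kernel_of_def ell1_mult_closed)
  qed
  interpret ring "ell1_algebra \<sigma>"
    by (rule ring_ell1)
  have "subgroup (kernel_of S) (add_monoid (ell1_algebra \<sigma>))"
  proof (rule add.subgroupI)
    fix a assume a: "a \<in> kernel_of S"
    then have "\<ominus>\<^bsub>ell1_algebra \<sigma>\<^esub> a = (\<lambda>n. - a n)"
      by (intro minus_equality) (auto simp: ell1_algebra_def kernel_of_def ell1_uminus)
    then show "\<ominus>\<^bsub>ell1_algebra \<sigma>\<^esub> a \<in> kernel_of S"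
      using a by (auto simp: kernel_of_def ell1_uminus)
  next
    have "(\<lambda>n. 0) \<in> kernel_of S"
      by (auto simp: kernel_of_def intro: finite_support_ell1[of "{}"])
    then show "kernel_of S \<noteq> {}" by blast
  qed (auto simp: ell1_algebra_def kernel_of_def ell1_add)
  then have "ideal (kernel_of S) (ell1_algebra \<sigma>)"
    by (rule idealI[OF ring_ell1]) (auto simp: ell1_algebra_def l_closed r_closed)
  moreover have "closedin ell1_topology (kernel_of S)"
    unfolding closedin_ell1_iff
  proof (intro conjI ballI impI)
    show "kernel_of S \<subseteq> ell1"
      by (auto simp: kernel_of_def)
    fix a assume a: "a \<in> ell1"
      and lim: "\<forall>e>0. \<exists>b\<in>kernel_of S. ell1_norm (\<lambda>n. a n - b n) < e"
    have "apply_bcontfun (a n) x = 0" if "x \<in> S" for n x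
    proof (rule ccontr)
      assume "apply_bcontfun (a n) x \<noteq> 0"
      \<comment> \<open>A nonzero value at \<open>x\<close> serves as the radius: \<open>b n\<close>
        vanishes at \<open>x\<close>, so \<open>b\<close> cannot be closer to \<open>a\<close> than
        that value.\<close>
      then obtain b where b: "b \<in> kernel_of S"
        "ell1_norm (\<lambda>n. a n - b n) < norm (apply_bcontfun (a n) x)"
        using lim zero_less_norm_iff by blast
      have "norm (apply_bcontfun (a n) x) = norm (apply_bcontfun (a n - b n) x)"
        using b(1) that by (simp add: kernel_of_def)
      also have "\<dots> \<le> norm (a n - b n)"
        by (rule norm_bounded)
      also have "\<dots> \<le> ell1_norm (\<lambda>n. a n - b n)"
        using b(1) a by (intro norm_coeff_le_ell1_norm ell1_diff) (auto simp: kernel_of_def)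
      finally show False
        using b(2) by simp
    qed
    with a show "a \<in> kernel_of S"
      by (simp add: kernel_of_def)
  qed
  ultimately show ?thesis
    by (simp add: closed_ideals_def)
qed

lemma kernel_of_wb:
  assumes "S \<in> invariant_closed_sets \<sigma>"
  shows "kernel_of S \<in> wb_closed_ideals \<sigma>"
  using kernel_of_closed_ideal[OF assms]
  by (auto simp: wb_closed_ideals_def well_behaved_def kernel_of_def proj_E_def
      embed0_eq_single single_ell1 single_def)

lemma subset_kernel_hull: "I \<in> closed_ideals \<sigma> \<Longrightarrow> I \<subseteq> kernel_of (hull_of I)"
  using closed_idealD(1)[of I] by (auto simp: kernel_of_def hull_of_def)

section \<open>Well behaved closed ideals are the kernels of their hulls\<close>

lemma kernel_hull_wb:
  assumes comp: "compact (UNIV :: 'x set)" and wb: "I \<in> wb_closed_ideals \<sigma>"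
  shows "kernel_of (hull_of I) = I"
proof (rule antisym)
  have I: "I \<in> closed_ideals \<sigma>"
    using wb by (simp add: wb_closed_ideals_def)
  note ID = closed_idealD[OF I]
  show "I \<subseteq> kernel_of (hull_of I)"
    by (rule subset_kernel_hull[OF I])
  define J where "J = {f. single 0 f \<in> I}"
  have coeff_J: "b n \<in> J" if "b \<in> I" for b n
  proof -
    \<comment> \<open>Multiplying on the right moves \<open>b n\<close> to degree 0 untwisted, since
      \<open>alpha\<close> fixes 1.\<close>
    have "ell1_mult \<sigma> b (single (- n) 1) \<in> I"
      using ID(5)[OF that single_ell1] .
    moreover have "proj_E (ell1_mult \<sigma> b (single (- n) 1)) = b n"
      by (simp add: proj_E_def ell1_mult_single_right)
    ultimately have "embed0 (b n) \<in> I"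
      using wb by (force simp: wb_closed_ideals_def well_behaved_def)
    then show ?thesis
      by (simp add: J_def embed0_eq_single)
  qed
  have "closed J"
  proof -
    have "f \<in> J" if f: "f \<in> closure J" for f
      unfolding J_def mem_Collect_eq
    proof (rule ID(6)[OF single_ell1])
      fix e :: real assume "e > 0"
      then obtain g where "g \<in> J" "dist g f < e"
        using f closure_approachable by blast
      moreover have "(\<lambda>n. single 0 f n - single 0 g n) = single 0 (f - g)"
        by (auto simp: single_def)
      ultimately show "\<exists>b\<in>I. ell1_norm (\<lambda>n. single 0 f n - b n) < e"
        by (intro bexI[of _ "single 0 g"])
          (auto simp: J_def ell1_norm_single dist_norm norm_minus_commute)
    qed
    then show ?thesis
      using closure_subset_eq by blast
  qed
  moreover have "0 \<in> J"
    using ID(2) by (simp add: J_def single_def[abs_def])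
  moreover have "f + g \<in> J" if "f \<in> J" "g \<in> J" for f g
  proof -
    have "(\<lambda>n. single 0 f n + single 0 g n) = single 0 (f + g)"
      by (auto simp: single_def)
    then show ?thesis
      using ID(3)[of "single 0 f" "single 0 g"] that by (simp add: J_def)
  qed
  moreover have "h * f \<in> J" if "f \<in> J" for f h
  proof -
    have "ell1_mult \<sigma> (single 0 h) (single 0 f) = single 0 (h * f)"
      by (auto simp: fun_eq_iff ell1_mult_single_left single_def)
    then show ?thesis
      using ID(4)[OF _ single_ell1, of "single 0 f" 0 h] that by (simp add: J_def)
  qed
  ultimately have vanishing_J: "f \<in> J"
    if "\<And>x. (\<And>g. g \<in> J \<Longrightarrow> apply_bcontfun g x = 0) \<Longrightarrow> apply_bcontfun f x = 0" for f
    using closed_ideal_bcontfun_vanishing[OF comp] that by blast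
  show "kernel_of (hull_of I) \<subseteq> I"
  proof
    fix a assume "a \<in> kernel_of (hull_of I)"
    then have a: "a \<in> ell1" "\<And>n x. x \<in> hull_of I \<Longrightarrow> apply_bcontfun (a n) x = 0"
      by (auto simp: kernel_of_def)
    \<comment> \<open>A common zero of \<open>J\<close> lies in the hull, because all coefficients
      of elements of \<open>I\<close> are in \<open>J\<close>.\<close>
    have "a n \<in> J" for n
      using coeff_J by (intro vanishing_J a(2)) (auto simp: hull_of_def)
    have monomial: "single n (a n) \<in> I" for n
    proof -
      have "ell1_mult \<sigma> (single 0 (a n)) (single n 1) = single n (a n)"
        by (auto simp: fun_eq_iff ell1_mult_single_left single_def)
      then show ?thesis
        using ID(5)[OF _ single_ell1, of "single 0 (a n)" n 1] \<open>a n \<in> J\<close> by (simp add: J_def)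
    qed
    have partial: "(\<lambda>n. if n \<in> F then a n else 0) \<in> I" if "finite F" for F
      using that
    proof (induction F rule: finite_induct)
      case (insert k F)
      have "(\<lambda>n. if n \<in> insert k F then a n else 0) =
          (\<lambda>n. single k (a k) n + (if n \<in> F then a n else 0))"
        using insert.hyps by (auto simp: single_def fun_eq_iff)
      then show ?case
        using ID(3)[OF monomial insert.IH] by simp
    qed (use ID(2) in simp)
    show "a \<in> I"
    proof (rule ID(6)[OF a(1)])
      fix e :: real assume "e > 0"
      have total: "((\<lambda>n. norm (a n)) has_sum ell1_norm a) UNIV"
        using a(1) by (auto simp: ell1_def ell1_norm_def)
      then obtain F where F: "finite F" "dist (\<Sum>n\<in>F. norm (a n)) (ell1_norm a) \<le> e / 2"
        using has_sum_finite_approximation[of _ _ _ "e / 2"] \<open>e > 0\<close> by (metis half_gt_zero)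
      \<comment> \<open>Cancelling the terms over \<open>F\<close> leaves the series of the tail,
        whose sum is the distance from \<open>a\<close> to its truncation.\<close>
      have "((\<lambda>n. if n \<in> F then - norm (a n) else 0) has_sum - (\<Sum>n\<in>F. norm (a n))) UNIV"
        using F(1) by (intro has_sum_finite_neutralI[of F]) (auto simp: sum_negf)
      from has_sum_add[OF total this]
      have "((\<lambda>n. norm (a n - (if n \<in> F then a n else 0))) has_sum
          ell1_norm a - (\<Sum>n\<in>F. norm (a n))) UNIV"
        unfolding diff_conv_add_uminus[of "ell1_norm a"]
        by (rule has_sum_cong[THEN iffD1, rotated]) auto
      then have "ell1_norm (\<lambda>n. a n - (if n \<in> F then a n else 0)) =
          ell1_norm a - (\<Sum>n\<in>F. norm (a n))"
        unfolding ell1_norm_def[of "\<lambda>n. a n - _ n"] by (rule infsumI)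
      then show "\<exists>b\<in>I. ell1_norm (\<lambda>n. a n - b n) < e"
        using F(2) \<open>e > 0\<close> by (intro bexI[OF _ partial[OF F(1)]]) (simp add: dist_real_def abs_if split: if_splits)
    qed
  qed
qed

end

section \<open>Hulls of kernels, by Urysohn's lemma\<close>

lemma hull_of_kernel_of:
  fixes S :: "'x::t2_space set"
  assumes comp: "compact (UNIV :: 'x set)" and "closed S"
  shows "hull_of (kernel_of S) = S"
proof (rule antisym)
  show "S \<subseteq> hull_of (kernel_of S)"
    by (auto simp: hull_of_def kernel_of_def)
  show "hull_of (kernel_of S) \<subseteq> S"
  proof
    fix x assume x: "x \<in> hull_of (kernel_of S)"
    show "x \<in> S"
    proof (rule ccontr)
      assume "x \<notin> S"
      have "compact_space (euclidean :: 'x topology)" "Hausdorff_space (euclidean :: 'x topology)"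
        using comp by (simp_all add: compact_space_def Hausdorff_space_def disjnt_def)
          (metis hausdorff)
      then have "normal_space (euclidean :: 'x topology)"
        by (intro compact_Hausdorff_or_regular_imp_normal_space disjI1)
      then obtain h where h: "continuous_map euclidean euclideanreal h" "h ` S \<subseteq> {0}" "h ` {x} \<subseteq> {1}"
        using Urysohn_lemma_alt[of euclidean S "{x}" 0 1] \<open>closed S\<close> \<open>x \<notin> S\<close> by auto
      have "apply_bcontfun (Bcontfun (\<lambda>y. complex_of_real (h y))) = (\<lambda>y. complex_of_real (h y))"
        using h(1) by (intro apply_Bcontfun_compact comp continuous_intros) auto
      \<comment> \<open>The separating function, placed in degree 0, lies in the kernel but has
        value 1 at \<open>x\<close>.\<close>
      moreover from this have "single 0 (Bcontfun (\<lambda>y. complex_of_real (h y))) \<in> kernel_of S"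
        using h(2) by (auto simp: kernel_of_def single_ell1 single_def)
      ultimately have "complex_of_real (h x) = 0"
        using x by (auto simp: hull_of_def single_def dest!: bspec spec[of _ 0])
      then show False
        using h(3) by simp
    qed
  qed
qed

section \<open>The correspondence between ideals and invariant sets\<close>

theorem theorem3p7:
  fixes \<sigma> :: "'x::t2_space \<Rightarrow> 'x"
  assumes "compact (UNIV :: 'x set)"
    and "homeomorphic_map euclidean euclidean \<sigma>"
  shows
    "hull_of \<in> closed_ideals \<sigma> \<rightarrow> invariant_closed_sets \<sigma> \<and>
     kernel_of \<in> invariant_closed_sets \<sigma> \<rightarrow> closed_ideals \<sigma> \<and>
     antimono_on (closed_ideals \<sigma>) hull_of \<and>
     antimono_on (invariant_closed_sets \<sigma>) kernel_of \<and>
     (\<forall>I\<in>closed_ideals \<sigma>. I \<subseteq> kernel_of (hull_of I)) \<and>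
     (\<forall>S\<in>invariant_closed_sets \<sigma>. hull_of (kernel_of S) = S) \<and>
     bij_betw hull_of (wb_closed_ideals \<sigma>) (invariant_closed_sets \<sigma>) \<and>
     bij_betw kernel_of (invariant_closed_sets \<sigma>) (wb_closed_ideals \<sigma>) \<and>
     (\<forall>I\<in>wb_closed_ideals \<sigma>. kernel_of (hull_of I) = I) \<and>
     (\<forall>S\<in>invariant_closed_sets \<sigma>. hull_of (kernel_of S) = S) \<and>
     (inj_on hull_of (closed_ideals \<sigma>) \<longleftrightarrow>
        (\<forall>I\<in>closed_ideals \<sigma>. \<exists>S\<in>invariant_closed_sets \<sigma>. I = kernel_of S)) \<and>
     (inj_on hull_of (closed_ideals \<sigma>) \<longleftrightarrow> (\<forall>I\<in>closed_ideals \<sigma>. well_behaved I)) \<and>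
     (inj_on hull_of (closed_ideals \<sigma>) \<longleftrightarrow>
        (\<forall>S\<in>invariant_closed_sets \<sigma>.
           kernel_of S \<in> closed_ideals \<sigma> \<and> hull_of (kernel_of S) = S \<and>
           (\<forall>I'\<in>closed_ideals \<sigma>. hull_of I' = S \<longrightarrow> I' = kernel_of S))) \<and>
     (\<forall>I\<in>wb_closed_ideals \<sigma>.
        hull_of I \<in> invariant_closed_sets \<sigma> \<and> kernel_of (hull_of I) = I \<and>
        (\<forall>S'\<in>invariant_closed_sets \<sigma>. kernel_of S' = I \<longrightarrow> S' = hull_of I)) \<and>
     (\<forall>I\<in>closed_ideals \<sigma>.
        kernel_of (hull_of I) \<in> wb_closed_ideals \<sigma> \<and> I \<subseteq> kernel_of (hull_of I) \<and>
        (\<forall>J\<in>wb_closed_ideals \<sigma>. I \<subseteq> J \<longrightarrow> kernel_of (hull_of I) \<subseteq> J)) \<and>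
     (\<forall>I\<in>closed_ideals \<sigma>.
        kernel_of (hull_of I) \<in> closed_ideals \<sigma> \<and>
        hull_of (kernel_of (hull_of I)) = hull_of I \<and>
        (\<forall>I'\<in>closed_ideals \<sigma>. hull_of I' = hull_of I \<longrightarrow> I' \<subseteq> kernel_of (hull_of I)))"
proof -
  obtain \<tau> where \<tau>: "homeomorphic_maps euclidean euclidean \<sigma> \<tau>"
    using assms(2) homeomorphic_map_maps by blast
  then have *: "continuous_on UNIV \<sigma>" "continuous_on UNIV \<tau>" "\<And>x. \<tau> (\<sigma> x) = x" "\<And>x. \<sigma> (\<tau> x) = x"
    by (auto simp: homeomorphic_maps_def)
  \<comment> \<open>Transfers the continuity of the two-sided inverse to the \<open>inv_into\<close>
    used in \<open>alpha\<close>.\<close>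
  have "inv_into UNIV \<sigma> = \<tau>"
    using *(3,4) by (intro inv_equality) auto
  moreover have "bij \<sigma>"
    using *(3,4) by (metis bijI')
  ultimately interpret homeomorphic_system \<sigma>
    using * by unfold_locales auto
  note hull = hull_of_invariant_closed and ker = kernel_of_closed_ideal and ker_wb = kernel_of_wb
    and sub = subset_kernel_hull and KH = kernel_hull_wb[OF assms(1)]
  have wb_iff: "I \<in> wb_closed_ideals \<sigma> \<longleftrightarrow> I \<in> closed_ideals \<sigma> \<and> well_behaved I" for I
    by (simp add: wb_closed_ideals_def)
  have HK: "hull_of (kernel_of S) = S" if "S \<in> invariant_closed_sets \<sigma>" for S
    using that by (intro hull_of_kernel_of assms) (simp add: invariant_closed_sets_def)
  have anti_H: "hull_of J \<subseteq> hull_of I" if "I \<subseteq> J" for I J :: "(int \<Rightarrow> 'x \<Rightarrow>\<^sub>C complex) set"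
    using that by (auto simp: hull_of_def)
  have anti_K: "kernel_of S' \<subseteq> kernel_of S" if "S \<subseteq> S'" for S S' :: "'x set"
    using that by (auto simp: kernel_of_def)
  have bij_H: "bij_betw hull_of (wb_closed_ideals \<sigma>) (invariant_closed_sets \<sigma>)"
    using KH HK hull ker_wb by (intro bij_betw_byWitness[of _ kernel_of]) (auto simp: wb_iff)
  have bij_K: "bij_betw kernel_of (invariant_closed_sets \<sigma>) (wb_closed_ideals \<sigma>)"
    using KH HK hull ker_wb by (intro bij_betw_byWitness[of _ hull_of]) (auto simp: wb_iff)
  \<comment> \<open>Pivot for all of (2): an ideal and the kernel of its hull have equal hulls, so
    injectivity identifies them; conversely the equation recovers an ideal from its hull.\<close>
  have inj_iff: "inj_on hull_of (closed_ideals \<sigma>) \<longleftrightarrow>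
      (\<forall>I\<in>closed_ideals \<sigma>. kernel_of (hull_of I) = I)"
    using HK hull ker by (metis inj_on_def)
  have inj_b: "inj_on hull_of (closed_ideals \<sigma>) \<longleftrightarrow>
      (\<forall>I\<in>closed_ideals \<sigma>. \<exists>S\<in>invariant_closed_sets \<sigma>. I = kernel_of S)"
    unfolding inj_iff using HK hull by metis
  have inj_c: "inj_on hull_of (closed_ideals \<sigma>) \<longleftrightarrow> (\<forall>I\<in>closed_ideals \<sigma>. well_behaved I)"
    unfolding inj_iff using KH hull ker_wb wb_iff by metis
  have inj_d: "inj_on hull_of (closed_ideals \<sigma>) \<longleftrightarrow>
      (\<forall>S\<in>invariant_closed_sets \<sigma>.
         kernel_of S \<in> closed_ideals \<sigma> \<and> hull_of (kernel_of S) = S \<and>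
         (\<forall>I'\<in>closed_ideals \<sigma>. hull_of I' = S \<longrightarrow> I' = kernel_of S))"
    unfolding inj_iff using HK hull ker by metis
  \<comment> \<open>Reversing inclusions twice turns I <= J into an inclusion of kernels of hulls,
    and a well behaved \<open>J\<close> equals its own.\<close>
  have smallest: "kernel_of (hull_of I) \<subseteq> J" if "J \<in> wb_closed_ideals \<sigma>" "I \<subseteq> J" for I J
    using anti_K[OF anti_H[OF that(2)]] KH[OF that(1)] by simp
  have largest: "I' \<subseteq> kernel_of (hull_of I)" if "I' \<in> closed_ideals \<sigma>" "hull_of I' = hull_of I" for I I'
    using sub[OF that(1)] that(2) by simp
  show ?thesis
    \<comment> \<open>Folding conditions (b), (c), (d) back into injectivity makes the three
      equivalences reflexive.\<close>
    unfolding inj_c[symmetric] inj_b[symmetric] inj_d[symmetric]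
    using bij_H bij_K
    by (intro conjI ballI impI funcsetI monotone_onI refl)
      (simp_all add: hull ker ker_wb HK KH sub anti_H anti_K smallest largest,
        auto simp: wb_iff hull HK)
qed

end
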